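(* Let $(x,y)\in\mathbb{R}^2$ and $r\ne0$ satisfy $\big(0<y\land r\le \tfrac{x^2+y^2}{2y}\big)\lor(y=0\land x<0)\lor\big(y<0\land \tfrac{x^2+y^2}{2y}\le r\big)$, so that the turn-to-bearing trajectory with radius $r$ and bearing offset $\Theta(x,y,r)$, starting at the origin with heading $0$, passes through $(x,y)$. Then the square of the distance travelled on the straight segment before arriving at $(x,y)$ satisfies $$\big(x-r\sin\Theta(x,y,r)\big)^2+\big(y-r(1-\cos\Theta(x,y,r))\big)^2=x^2-(2r-y)y.$$
   Context: $\mathrm{atan}$ is the one-argument arctangent with values in $(-\pi/2,\pi/2)$. $\Theta(x,y,r)=2\,\mathrm{atan}\!\Big(\dfrac{x-\sqrt{x^2-(2r-y)y}}{2r-y}\Big)+P(x,y,r)$ if $2r-y\ne0$; $\Theta(x,y,r)=2\,\mathrm{atan}(y/(2x))$ if $2r-y=0$ and $x>0$; $\Theta(x,y,r)=\pi\,\mathrm{sign}(r)$ if $2r-y=0$ and $x\le0$. $P(x,y,r)=0$ if $\big(0<r\land((0<x\land0<y)\lor(x\le0\land 2r<y))\big)\lor\big(r<0\land((x<0\land y<0)\lor y<2r)\big)$; $P=2\pi$ if $0<r\land((0\le x\land y<0)\lor(x<0\land y<2r))$; $P=-2\pi$ if $r<0\land((0\le x\land 0<y)\lor(x<0\land 2r<y))$. A turn-to-bearing path from the origin with heading $0$, signed radius $r$ (positive = left turn) and bearing offset $\theta_c$ follows the circular arc $d\mapsto(r\sin(d/r),r(1-\cos(d/r)))$ for $0\le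 d\le r\theta_c$ and then the tangent straight line with heading $\theta_c$.
   Formalization: The cases of P overlap for r<0, x<0, 2r<y<0 (values 0 and −2π) and leave a gap for r<0, x>0, 2r<y<0; here P takes the value ±2π whenever one of those clauses applies, and 0 everywhere else. *)

theory Defs
  imports Complex_Main
begin

(* Multiple of 2*pi that selects the branch of the turning angle, so that it has the sign of r.
   In the published case distinction the value 0 is listed for
     (0 < r & ((0 < x & 0 < y) | (x <= 0 & 2*r < y))) | (r < 0 & ((x < 0 & y < 0) | y < 2*r)).
   Those cases overlap the -2*pi cases where x < 0, 2*r < y < 0, and no case covers, for
   instance, x > 0, 2*r < y < 0 ("x < 0 & y < 0" is presumably a misprint for "0 < x & y < 0").
   Here the nonzero values take precedence, and 0 is the value everywhere else; this makes
   P odd under the reflection (y, r) -> (-y, -r) at every point admitting such a path. *)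
definition P :: "real \<Rightarrow> real \<Rightarrow> real \<Rightarrow> real" where
  "P x y r =
    (if 0 < r \<and> ((0 \<le> x \<and> y < 0) \<or> (x < 0 \<and> y < 2 * r)) then 2 * pi
     else if r < 0 \<and> ((0 \<le> x \<and> 0 < y) \<or> (x < 0 \<and> 2 * r < y)) then - 2 * pi
     else 0)"

definition Theta :: "real \<Rightarrow> real \<Rightarrow> real \<Rightarrow> real" where
  "Theta x y r =
    (if 2 * r - y \<noteq> 0 then
       2 * arctan ((x - sqrt (x\<^sup>2 - (2 * r - y) * y)) / (2 * r - y)) + P x y r
     else if x > 0 then 2 * arctan (y / (2 * x))
     else pi * sgn r)"

(* Position after travelling distance d >= 0, starting at the origin with heading 0: a circular arc
   of signed radius r (positive = left turn) and length r * \<theta>, then its tangent line with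
   heading \<theta>.  Meaningful for r \<noteq> 0 and 0 \<le> r * \<theta>. *)
definition ttb_path :: "real \<Rightarrow> real \<Rightarrow> real \<Rightarrow> real \<times> real" where
  "ttb_path r \<theta> d =
    (if d \<le> r * \<theta> then (r * sin (d / r), r * (1 - cos (d / r)))
     else (r * sin \<theta> + (d - r * \<theta>) * cos \<theta>,
           r * (1 - cos \<theta>) + (d - r * \<theta>) * sin \<theta>))"

(* The part of the travelled distance d that lies on the straight segment. *)
definition straight_dist :: "real \<Rightarrow> real \<Rightarrow> real \<Rightarrow> real" where
  "straight_dist r \<theta> d = max 0 (d - r * \<theta>)"

end

theory Submission
  imports Defs
begin

text \<open>
  Put S = sqrt (x^2 - (2r - y) y). The point at distance S along the tangent line of heading
  \<open>\<theta>\<close> is (x, y) iff t = tan (\<open>\<theta>\<close>/2) is a common root of (x + S) t^2 - 2 r t + (x - S) and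
  (2r - y) t^2 + 2 S t - y, and t = (x - S) / (2r - y) is such a root because
  (x - S) (x + S) = (2r - y) y. The branch P affects only the sign of the angle.
  Conversely, S vanishes at every point of the arc, so S is the straight distance of
  every visit to (x, y).
\<close>

lemma cos_double_arctan: "cos (2 * arctan t) = (1 - t\<^sup>2) / (1 + t\<^sup>2)"
proof -
  have "1 + t\<^sup>2 > 0" by (simp add: add_pos_nonneg)
  then show ?thesis
    by (simp add: cos_double cos_arctan sin_arctan power_divide diff_divide_distrib)
qed

lemma sin_double_arctan: "sin (2 * arctan t) = 2 * t / (1 + t\<^sup>2)"
proof -
  have "1 + t\<^sup>2 > 0" by (simp add: add_pos_nonneg)
  then show ?thesis
    by (simp add: sin_double cos_arctan sin_arctan)
qed

text \<open>The half-angle formulas give both coordinates the denominator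
  \<open>1 + t\<^sup>2\<close>; the two hypotheses are the coordinate equations multiplied by
  it.\<close>

lemma tangent_point_double_arctan:
  fixes x y r S t :: real
  assumes "(x + S) * t\<^sup>2 - 2 * r * t + (x - S) = 0"
    and "(2 * r - y) * t\<^sup>2 + 2 * S * t - y = 0"
  shows "r * sin (2 * arctan t) + S * cos (2 * arctan t) = x"
    and "r * (1 - cos (2 * arctan t)) + S * sin (2 * arctan t) = y"
proof -
  have "1 + t\<^sup>2 > 0" by (simp add: add_pos_nonneg)
  then have nz: "1 + t\<^sup>2 \<noteq> 0" by simp
  have "r * sin (2 * arctan t) + S * cos (2 * arctan t)
      = (2 * r * t + S * (1 - t\<^sup>2)) / (1 + t\<^sup>2)"
    by (simp add: cos_double_arctan sin_double_arctan add_divide_distrib)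
  also have "2 * r * t + S * (1 - t\<^sup>2) = x * (1 + t\<^sup>2)"
    using assms(1) by (simp add: algebra_simps)
  finally show "r * sin (2 * arctan t) + S * cos (2 * arctan t) = x"
    using nz by simp
  have "1 - cos (2 * arctan t) = 2 * t\<^sup>2 / (1 + t\<^sup>2)"
    unfolding cos_double_arctan using nz by (simp add: field_simps)
  then have "r * (1 - cos (2 * arctan t)) + S * sin (2 * arctan t)
      = (2 * r * t\<^sup>2 + 2 * S * t) / (1 + t\<^sup>2)"
    unfolding sin_double_arctan by (simp add: add_divide_distrib mult_ac)
  also have "2 * r * t\<^sup>2 + 2 * S * t = y * (1 + t\<^sup>2)"
    using assms(2) by (simp add: algebra_simps)
  finally show "r * (1 - cos (2 * arctan t)) + S * sin (2 * arctan t) = y"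
    using nz by simp
qed

lemma sin_add_P: "sin (a + P x y r) = sin a"
  \<comment> \<open>Periodicity at \<open>a - 2 * pi\<close> settles the value
    \<open>- 2 * pi\<close> of \<open>P\<close>.\<close>
  using sin_periodic[of "a - 2 * pi"] by (simp add: P_def)

lemma cos_add_P: "cos (a + P x y r) = cos a"
  using cos_periodic[of "a - 2 * pi"] by (simp add: P_def)

lemma tangent_point_Theta:
  fixes x y r :: real
  defines "S \<equiv> sqrt (x\<^sup>2 - (2 * r - y) * y)"
  assumes r: "r \<noteq> 0" and nonneg: "0 \<le> x\<^sup>2 - (2 * r - y) * y"
  shows "r * sin (Theta x y r) + S * cos (Theta x y r) = x"
    and "r * (1 - cos (Theta x y r)) + S * sin (Theta x y r) = y"
proof -
  have S2: "S\<^sup>2 = x\<^sup>2 - (2 * r - y) * y"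
    using nonneg by (simp add: S_def)
  have "r * sin (Theta x y r) + S * cos (Theta x y r) = x \<and>
        r * (1 - cos (Theta x y r)) + S * sin (Theta x y r) = y"
  proof (cases "2 * r - y = 0")
    case False
    define w where "w = 2 * r - y"
    define t where "t = (x - S) / w"
    have wt: "w * t = x - S" using False by (simp add: t_def w_def)
    \<comment> \<open>Cancelling \<open>w\<close> in this difference of squares yields
      \<open>(x + S) * t = y\<close>, the companion of \<open>w * t = x - S\<close>. Both quadratics
      follow from these two linear relations.\<close>
    have "w * ((x + S) * t) = (x + S) * (x - S)" by (simp flip: wt)
    also have "\<dots> = x\<^sup>2 - S\<^sup>2" by (simp add: power2_eq_square algebra_simps)
    also have "\<dots> = w * y" by (simp add: S2 w_def)
    finally have "w * ((x + S) * t) = w * y" .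
    then have yt: "(x + S) * t = y" using False by (simp add: w_def)
    have t2: "(x + S) * t\<^sup>2 = y * t" "w * t\<^sup>2 = (x - S) * t"
      by (simp_all add: power2_eq_square flip: yt wt)
    have 1: "(x + S) * t\<^sup>2 - 2 * r * t + (x - S) = 0"
      unfolding t2 by (simp add: w_def algebra_simps flip: wt)
    have 2: "(2 * r - y) * t\<^sup>2 + 2 * S * t - y = 0"
      unfolding w_def[symmetric] t2 by (simp add: algebra_simps flip: yt)
    have "Theta x y r = 2 * arctan t + P x y r"
      using False by (simp add: Theta_def t_def S_def w_def)
    then show ?thesis
      using tangent_point_double_arctan[OF 1 2] by (simp add: sin_add_P cos_add_P)
  next
    case True
    then have y: "y = 2 * r" and S: "S = \<bar>x\<bar>" by (simp_all add: S_def)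
    show ?thesis
    proof (cases "x > 0")
      case True
      \<comment> \<open>Here \<open>S = x\<close> and the second quadratic degenerates to a linear
        equation with root \<open>y / (2 * x) = r / x\<close>.\<close>
      have "(x + S) * (r / x)\<^sup>2 - 2 * r * (r / x) + (x - S) = 0"
        and "(2 * r - y) * (r / x)\<^sup>2 + 2 * S * (r / x) - y = 0"
        using True S y by (simp_all add: power2_eq_square)
      moreover have "Theta x y r = 2 * arctan (r / x)"
        using y True by (simp add: Theta_def)
      ultimately show ?thesis
        using tangent_point_double_arctan[of x S "r / x" r y] by simp
    next
      case False
      \<comment> \<open>Now \<open>S = - x\<close>: a half turn of either sign ends at
        \<open>(0, 2 * r)\<close> heading in the negative x direction.\<close>
      have "Theta x y r = pi \<or> Theta x y r = - pi"
        using y r False by (auto simp: Theta_def sgn_if)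
      then show ?thesis using y S False by auto
    qed
  qed
  then show "r * sin (Theta x y r) + S * cos (Theta x y r) = x"
    and "r * (1 - cos (Theta x y r)) + S * sin (Theta x y r) = y" by simp_all
qed

lemma P_uminus_uminus:
  assumes "y \<noteq> 0 \<or> x < 0"
  shows "P x (- y) (- r) = - P x y r"
  using assms by (auto simp: P_def)

text \<open>Mirror symmetry in the line of the initial heading: the square root is unchanged, while
  the argument of \<open>arctan\<close> and \<open>P\<close> change sign. This reduces right turns
  to left turns.\<close>

lemma Theta_uminus_uminus:
  assumes "y \<noteq> 0 \<or> x < 0"
  shows "Theta x (- y) (- r) = - Theta x y r"
proof -
  have "(x - sqrt (x\<^sup>2 - (2 * - r - - y) * - y)) / (2 * - r - - y)
      = - ((x - sqrt (x\<^sup>2 - (2 * r - y) * y)) / (2 * r - y))"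
    by (simp add: minus_divide_right algebra_simps)
  then show ?thesis
    using P_uminus_uminus[OF assms, of r]
    by (auto simp: Theta_def arctan_minus sgn_minus)
qed

text \<open>Since \<open>2 * arctan t\<close> exceeds \<open>- pi\<close>, adding
  \<open>2 * pi\<close> makes it positive; where \<open>P\<close> vanishes, \<open>t\<close> itself
  is nonnegative.\<close>

lemma Theta_nonneg:
  assumes r: "0 < r" and xy: "y \<noteq> 0 \<or> x < 0"
  shows "0 \<le> Theta x y r"
proof (cases "2 * r - y = 0")
  case True
  then show ?thesis using r by (simp add: Theta_def)
next
  case w: False
  define S where "S = sqrt (x\<^sup>2 - (2 * r - y) * y)"
  define t where "t = (x - S) / (2 * r - y)"
  have Th: "Theta x y r = 2 * arctan t + P x y r"
    using w by (simp add: Theta_def t_def S_def)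
  show ?thesis
  proof (cases "P x y r = 2 * pi")
    case True
    then show ?thesis using Th arctan_lbound[of t] pi_gt_zero by linarith
  next
    case False
    then have np: "\<not> (0 \<le> x \<and> y < 0)" "\<not> (x < 0 \<and> y < 2 * r)" and P0: "P x y r = 0"
      using r by (auto simp: P_def)
    have "0 \<le> t"
    proof (cases "2 * r < y")
      case True
      \<comment> \<open>This gives \<open>x \<le> S\<close>, so the numerator of \<open>t\<close> is
        nonpositive and its denominator negative.\<close>
      have "(2 * r - y) * y \<le> 0"
        using True r by (intro mult_nonpos_nonneg) auto
      then have "x\<^sup>2 \<le> x\<^sup>2 - (2 * r - y) * y" by simp
      then have "x \<le> S" unfolding S_def by (rule real_le_rsqrt)
      then show ?thesis using True by (simp add: t_def divide_nonpos_neg)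
    next
      case False
      then have "0 < 2 * r - y" "0 \<le> x" "0 \<le> y" using w np by auto
      \<comment> \<open>The radicand may be negative here; \<open>sqrt\<close> is then negative too,
        and the bound by \<open>x\<close> persists.\<close>
      then have "x\<^sup>2 - (2 * r - y) * y \<le> x\<^sup>2" by simp
      then have "S \<le> x" unfolding S_def using \<open>0 \<le> x\<close> by (rule real_le_lsqrt[OF _ , rotated])
      then show ?thesis using \<open>0 < 2 * r - y\<close> by (simp add: t_def)
    qed
    then show ?thesis using Th P0 by simp
  qed
qed

text \<open>The product is the length of the arc, so \<open>Theta\<close> turns in the direction
  given by the sign of \<open>r\<close>.\<close>

lemma mult_Theta_nonneg:
  assumes "r \<noteq> 0" and "y \<noteq> 0 \<or> x < 0"
  shows "0 \<le> r * Theta x y r"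
proof (cases "0 < r")
  case True
  then show ?thesis using Theta_nonneg assms by simp
next
  case False
  then have "0 \<le> Theta x (- y) (- r)" using assms by (intro Theta_nonneg) auto
  then show ?thesis
    using False Theta_uminus_uminus[OF assms(2)] by (simp add: mult_nonpos_nonpos)
qed

text \<open>The heading is a unit vector. This serves both for the square root \<open>S\<close> and
  for the straight part \<open>d - r * \<theta>\<close> of an arbitrary visit.\<close>

lemma tangent_dist_power2:
  fixes x y a b S \<theta> :: real
  assumes "a + S * cos \<theta> = x" and "b + S * sin \<theta> = y"
  shows "(x - a)\<^sup>2 + (y - b)\<^sup>2 = S\<^sup>2"
proof -
  have "x - a = S * cos \<theta>" "y - b = S * sin \<theta>"
    using assms by simp_all
  then show ?thesis by (simp add: power_mult_distrib flip: distrib_left)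
qed

text \<open>The radicand equals \<open>x\<^sup>2 + (y - r)\<^sup>2 - r\<^sup>2\<close>, the power of
  the point with respect to the turning circle with centre \<open>(0, r)\<close>, so it vanishes on
  the arc.\<close>

lemma arc_point_power:
  fixes r a :: real
  shows "(r * sin a)\<^sup>2 - (2 * r - r * (1 - cos a)) * (r * (1 - cos a)) = 0"
proof -
  have "(r * sin a)\<^sup>2 - (2 * r - r * (1 - cos a)) * (r * (1 - cos a))
      = r\<^sup>2 * (sin a)\<^sup>2 - r\<^sup>2 * (1 - (cos a)\<^sup>2)"
    by (simp add: power2_eq_square algebra_simps)
  then show ?thesis by (simp add: sin_squared_eq)
qed

theorem theorem3:
  fixes x y r :: real
  assumes "r \<noteq> 0"
    and "(0 < y \<and> r \<le> (x\<^sup>2 + y\<^sup>2) / (2 * y)) \<or> (y = 0 \<and> x < 0)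
      \<or> (y < 0 \<and> (x\<^sup>2 + y\<^sup>2) / (2 * y) \<le> r)"
  shows "0 \<le> r * Theta x y r
    \<and> (\<exists>d\<ge>0. ttb_path r (Theta x y r) d = (x, y))
    \<and> (\<forall>d\<ge>0. ttb_path r (Theta x y r) d = (x, y) \<longrightarrow>
          (straight_dist r (Theta x y r) d)\<^sup>2 =
            (x - r * sin (Theta x y r))\<^sup>2 + (y - r * (1 - cos (Theta x y r)))\<^sup>2)
    \<and> (x - r * sin (Theta x y r))\<^sup>2 + (y - r * (1 - cos (Theta x y r)))\<^sup>2
        = x\<^sup>2 - (2 * r - y) * y"
proof -
  define \<theta> where "\<theta> = Theta x y r"
  define S where "S = sqrt (x\<^sup>2 - (2 * r - y) * y)"
  \<comment> \<open>Multiplying by \<open>2 * y\<close> unifies the three cases: the inequality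
    flips when \<open>y < 0\<close>. It says that the point is not inside the turning
    circle.\<close>
  have "2 * r * y \<le> x\<^sup>2 + y\<^sup>2"
    using assms(2) by (auto simp: field_simps)
  then have nonneg: "0 \<le> x\<^sup>2 - (2 * r - y) * y"
    by (simp add: power2_eq_square algebra_simps)
  have S: "0 \<le> S" "S\<^sup>2 = x\<^sup>2 - (2 * r - y) * y"
    using nonneg by (simp_all add: S_def)
  have point: "r * sin \<theta> + S * cos \<theta> = x" "r * (1 - cos \<theta>) + S * sin \<theta> = y"
    using tangent_point_Theta[OF assms(1) nonneg] by (simp_all add: \<theta>_def S_def)
  have sgn: "0 \<le> r * \<theta>"
    unfolding \<theta>_def using assms by (intro mult_Theta_nonneg) auto
  have dist: "(x - r * sin \<theta>)\<^sup>2 + (y - r * (1 - cos \<theta>))\<^sup>2 = x\<^sup>2 - (2 * r - y) * y"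
    using tangent_dist_power2[OF point] S(2) by simp
  \<comment> \<open>For \<open>S = 0\<close> this distance falls into the arc branch, where
    \<open>d / r = \<theta>\<close> because \<open>r \<noteq> 0\<close>.\<close>
  have "ttb_path r \<theta> (r * \<theta> + S) = (x, y)"
    using point S(1) assms(1) by (auto simp: ttb_path_def)
  then have ex: "\<exists>d\<ge>0. ttb_path r \<theta> d = (x, y)"
    using sgn S(1) by (intro exI[of _ "r * \<theta> + S"]) simp
  have "(straight_dist r \<theta> d)\<^sup>2 = (x - r * sin \<theta>)\<^sup>2 + (y - r * (1 - cos \<theta>))\<^sup>2"
    if "ttb_path r \<theta> d = (x, y)" for d
  proof (cases "d \<le> r * \<theta>")
    case True
    then have "x = r * sin (d / r)" "y = r * (1 - cos (d / r))"
      using that by (auto simp: ttb_path_def)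
    then have "x\<^sup>2 - (2 * r - y) * y = 0"
      by (simp only: arc_point_power)
    then show ?thesis using True dist by (simp add: straight_dist_def)
  next
    case False
    then have "r * sin \<theta> + (d - r * \<theta>) * cos \<theta> = x"
      "r * (1 - cos \<theta>) + (d - r * \<theta>) * sin \<theta> = y"
      using that by (auto simp: ttb_path_def)
    from tangent_dist_power2[OF this] show ?thesis
      using False by (simp add: straight_dist_def)
  qed
  then show ?thesis
    using sgn ex dist by (simp add: \<theta>_def)
qed

end
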